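(* Let $\mathbf T$ be an operator and $f$ a function such that $\mathbf Tf$ is a measurable function on $\mathbb{R}^n$. Assume that there exist $R_0\ge1$ and $G_f\in L^1(\mathbb S^{n-1})$ such that $\mathbf Tf\in L^{p_0}(B(0,R_0))$ for some $p_0>1$, $$r^n|\mathbf Tf(r\theta)|\le G_f(\theta)\qquad\text{for all }r\ge R_0\text{ and a.e. }\theta\in\mathbb S^{n-1},$$ and that the limit $$A_f(\theta):=\lim_{r\to\infty}r^n|\mathbf Tf(r\theta)|$$ exists for almost every $\theta\in\mathbb S^{n-1}$. Then, for every $\gamma>0$, $$\lim_{\lambda\to0^+}\lambda\,W_\gamma\left(\left\{x\in\mathbb{R}^n:\frac{|\mathbf Tf(x)|}{|x|^{\gamma-n}}>\lambda\right\}\right)=\frac1\gamma\int_{\mathbb S^{n-1}}A_f(\theta)\,d\theta,$$ and, for every $\gamma<0$, $$\lim_{\lambda\to\infty}\lambda\,W_\gamma\left(\left\{x\in\mathbb{R}^n:\frac{|\mathbf Tf(x)|}{|x|^{\gamma-n}}>\lambda\right\}\right)=\frac1{-\gamma}\int_{\mathbb S^{n-1}}A_f(\theta)\,d\theta.$$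
   Context: For $\gamma\neq0$ and measurable $E\subset\mathbb{R}^n$, $W_\gamma(E):=\int_E|x|^{\gamma-n}\,dx$. $d\theta$ is surface measure on the unit sphere $\mathbb S^{n-1}$. *)

theory Defs
  imports "HOL-Analysis.Analysis"
begin

text \<open>The dimension is \<open>n = CARD('n)\<close>; "measurable" means Lebesgue measurable.\<close>

text \<open>The values of \<open>W \<gamma> E\<close> may be infinite, so it is an extended nonnegative real. The value of
  the integrand at the origin (where \<open>0 powr a = 0\<close>) is immaterial.\<close>

definition W :: "real \<Rightarrow> (real ^ 'n) set \<Rightarrow> ennreal" where
  "W \<gamma> E = (\<integral>\<^sup>+x\<in>E. ennreal (norm x powr (\<gamma> - real CARD('n))) \<partial>lebesgue)"

text \<open>Surface measure on the unit sphere, normalised so that Lebesgue measure is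
  \<open>r\<^sup>n\<^sup>-\<^sup>1 dr d\<theta>\<close> in polar coordinates: a Borel set \<open>A\<close> of the sphere has measure \<open>n\<close> times the
  volume of the cone \<open>{r \<theta> | 0 < r < 1, \<theta> \<in> A}\<close> (for \<open>n = 1\<close> this is counting measure on
  \<open>{-1, 1}\<close>). Here \<open>sgn x = x / |x|\<close> is the radial projection. The measure is completed, since
  for a merely Lebesgue measurable function on the space the radial limits need not be Borel on
  the sphere.\<close>

definition borel_surface_measure :: "(real ^ 'n) measure" where
  "borel_surface_measure =
     scale_measure (of_nat CARD('n))
       (distr (restrict_space lborel (ball 0 1 - {0})) (restrict_space borel (sphere 0 1)) sgn)"

definition surface_measure :: "(real ^ 'n) measure" where
  "surface_measure = completion borel_surface_measure"

lemma space_surface_measure [simp]: "space surface_measure = sphere 0 1"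
  by (simp add: surface_measure_def borel_surface_measure_def space_scale_measure)

lemma sgn_measurable_sphere:
  "sgn \<in> restrict_space lborel (ball 0 1 - {0 :: real ^ 'n}) \<rightarrow>\<^sub>M restrict_space borel (sphere 0 1)"
proof (rule measurable_restrict_space2)
  show "sgn \<in> space (restrict_space lborel (ball 0 1 - {0 :: real ^ 'n})) \<rightarrow> sphere 0 1"
    by (auto simp: norm_sgn)
  have "(\<lambda>x :: real ^ 'n. x /\<^sub>R norm x) \<in> borel_measurable borel"
    by measurable
  then show "sgn \<in> borel_measurable (restrict_space lborel (ball 0 1 - {0 :: real ^ 'n}))"
    by (intro measurable_restrict_space1) (simp add: sgn_div_norm[abs_def])
qed

lemma emeasure_surface_measure:
  fixes A :: "(real ^ 'n) set"
  assumes "A \<in> sets borel" and "A \<subseteq> sphere 0 1"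
  shows "emeasure surface_measure A =
    of_nat CARD('n) * emeasure lborel {r *\<^sub>R \<theta> | r \<theta>. 0 < r \<and> r < 1 \<and> \<theta> \<in> A}"
proof -
  let ?M = "restrict_space lborel (ball 0 1 - {0 :: real ^ 'n})"
  have A: "A \<in> sets (restrict_space borel (sphere 0 1))"
    using assms by (auto simp: sets_restrict_space_iff)
  have eq: "sgn -` A \<inter> space ?M = {r *\<^sub>R \<theta> | r \<theta>. 0 < r \<and> r < 1 \<and> \<theta> \<in> A}"
  proof (intro equalityI subsetI)
    fix x assume x: "x \<in> sgn -` A \<inter> space ?M"
    then have "x = norm x *\<^sub>R sgn x" "0 < norm x" "norm x < 1" "sgn x \<in> A"
      by (auto simp: sgn_div_norm space_restrict_space)
    then show "x \<in> {r *\<^sub>R \<theta> | r \<theta>. 0 < r \<and> r < 1 \<and> \<theta> \<in> A}" by blast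
  next
    fix x assume "x \<in> {r *\<^sub>R \<theta> | r \<theta>. 0 < r \<and> r < 1 \<and> \<theta> \<in> A}"
    then obtain r \<theta> where x: "x = r *\<^sub>R \<theta>" "0 < r" "r < 1" "\<theta> \<in> A" by blast
    with assms have "norm \<theta> = 1" by auto
    with x show "x \<in> sgn -` A \<inter> space ?M"
      by (auto simp: sgn_div_norm space_restrict_space)
  qed
  have "emeasure surface_measure A = of_nat CARD('n) * emeasure ?M (sgn -` A \<inter> space ?M)"
    using A by (simp add: surface_measure_def borel_surface_measure_def emeasure_completion
        emeasure_distr[OF sgn_measurable_sphere])
  also have "emeasure ?M (sgn -` A \<inter> space ?M) = emeasure lborel (sgn -` A \<inter> space ?M)"
    by (rule emeasure_restrict_space) (auto simp: space_restrict_space)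
  finally show ?thesis by (simp only: eq)
qed

text \<open>Membership in \<open>L\<^sup>p(S)\<close> for \<open>0 < p \<le> \<infinity>\<close>.\<close>

definition in_Lp :: "ereal \<Rightarrow> (real ^ 'n) set \<Rightarrow> (real ^ 'n \<Rightarrow> complex) \<Rightarrow> bool" where
  "in_Lp p S g \<longleftrightarrow>
     g \<in> borel_measurable (lebesgue_on S) \<and>
     (if p = \<infinity> then \<exists>C. AE x in lebesgue_on S. norm (g x) \<le> C
      else integrable (lebesgue_on S) (\<lambda>x. norm (g x) powr real_of_ereal p))"

definition radial_limit :: "(real ^ 'n \<Rightarrow> complex) \<Rightarrow> real ^ 'n \<Rightarrow> real" where
  "radial_limit g \<theta> = Lim at_top (\<lambda>r. r ^ CARD('n) * norm (g (r *\<^sub>R \<theta>)))"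

end

theory Submission
  imports Defs
begin

text \<open>Put \<open>s = t\<^sup>-\<^sup>\<gamma>\<close>, so that \<open>t\<close> tends to infinity in both regimes, and split the
  level set at \<open>|x| = R\<^sub>0\<close>. Inside the ball, the level set condition bounds the weighted
  integrand by the integrable function \<open>|T f|\<close>, and it tends to \<open>0\<close> pointwise. Outside,
  the dilation \<open>x = t y\<close> absorbs the factor \<open>s\<close> and turns the level set into
  \<open>{y. |y|\<^sup>\<gamma> < |t y|\<^sup>n |T f (t y)|}\<close>, which converges to the set where
  \<open>|y|\<^sup>\<gamma> < A (y / |y|)\<close> and is dominated by the corresponding set for \<open>G\<close>. In polar
  coordinates the weighted measures of these sets are the integrals of \<open>A\<close> and \<open>G\<close> over the
  sphere, divided by \<open>|\<gamma>|\<close>. As the radial bound holds for each \<open>r\<close> only up to a null set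
  of directions depending on \<open>r\<close>, dominated convergence is applied along sequences, with a
  Borel version of \<open>|T f|\<close>.\<close>

section \<open>Dilations and one-dimensional integrals of powers\<close>

lemma nn_integral_lborel_scaleR:
  fixes f :: "'a::euclidean_space \<Rightarrow> ennreal"
  assumes [measurable]: "f \<in> borel_measurable borel" and "c > 0"
  shows "(\<integral>\<^sup>+x. f x \<partial>lborel) = ennreal (c ^ DIM('a)) * (\<integral>\<^sup>+x. f (c *\<^sub>R x) \<partial>lborel)"
  by (subst lborel_affine[of c 0])
    (use assms in \<open>simp_all add: nn_integral_density nn_integral_distr nn_integral_cmult\<close>)

lemma nn_integral_has_integral_if:
  fixes f :: "real \<Rightarrow> real"
  assumes [measurable]: "f \<in> borel_measurable borel" "S \<in> sets borel"
    and "\<And>x. x \<in> S \<Longrightarrow> 0 \<le> f x" and "(f has_integral I) S"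
  shows "(\<integral>\<^sup>+x. (if x \<in> S then ennreal (f x) else 0) \<partial>lborel) = ennreal I"
proof -
  have "((\<lambda>x. if x \<in> S then f x else 0) has_integral I) UNIV"
    using assms(4) by (simp add: has_integral_restrict_UNIV)
  from nn_integral_has_integral_lborel[OF _ _ this] assms(3)
  have "(\<integral>\<^sup>+x. ennreal (if x \<in> S then f x else 0) \<partial>lborel) = ennreal I"
    by simp
  then show ?thesis by (simp add: if_distrib cong: if_cong)
qed

lemma nn_integral_powr_greaterThan:
  fixes a e :: real
  assumes "a > 0" "e < 0"
  shows "(\<integral>\<^sup>+r. (if a < r then ennreal (r powr (e - 1)) else 0) \<partial>lborel) = ennreal (a powr e / - e)"
proof -
  have "(\<integral>\<^sup>+r. (if a < r then ennreal (r powr (e - 1)) else 0) \<partial>lborel)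
      = (\<integral>\<^sup>+r. (if r \<in> {a..} then ennreal (r powr (e - 1)) else 0) \<partial>lborel)"
    by (intro nn_integral_cong_AE eventually_mono[OF AE_lborel_singleton[of a]]) auto
  also have "\<dots> = ennreal (a powr e / - e)"
    using has_integral_powr_to_inf[of "e - 1" a] assms
    by (intro nn_integral_has_integral_if) auto
  finally show ?thesis .
qed

lemma nn_integral_powr_lessThan:
  fixes c e :: real
  assumes "c \<ge> 0" "e > 0"
  shows "(\<integral>\<^sup>+r. (if 0 < r \<and> r < c then ennreal (r powr (e - 1)) else 0) \<partial>lborel) = ennreal (c powr e / e)"
proof -
  have "(\<integral>\<^sup>+r. (if 0 < r \<and> r < c then ennreal (r powr (e - 1)) else 0) \<partial>lborel)
      = (\<integral>\<^sup>+r. (if r \<in> {0..c} then ennreal (r powr (e - 1)) else 0) \<partial>lborel)"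
    by (intro nn_integral_cong_AE
        eventually_mono[OF eventually_conj[OF AE_lborel_singleton[of 0] AE_lborel_singleton[of c]]]) auto
  also have "\<dots> = ennreal (c powr e / e)"
    using has_integral_powr_from_0[of "e - 1" c] assms
    by (intro nn_integral_has_integral_if) auto
  finally show ?thesis .
qed

text \<open>With \<open>c = a powr (1 / \<gamma>)\<close> the domain of integration is
  \<open>0 < r < c\<close> for positive exponents and \<open>r > c\<close> for negative ones. Both
  integrals equal \<open>c powr \<gamma> / \<bar>\<gamma>\<bar>\<close>, so the sign of the exponent
  disappears from the result. This is what gives the two regimes a common treatment.\<close>

lemma nn_integral_powr_superlevel:
  fixes a \<gamma> :: real
  assumes "a \<ge> 0" "\<gamma> \<noteq> 0"
  shows "(\<integral>\<^sup>+r. (if 0 < r \<and> r powr \<gamma> < a then ennreal (r powr (\<gamma> - 1)) else 0) \<partial>lborel)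
    = ennreal (a / \<bar>\<gamma>\<bar>)"
proof (cases "a = 0")
  case True
  have "(\<lambda>r. if 0 < r \<and> r powr \<gamma> < a then ennreal (r powr (\<gamma> - 1)) else 0) = (\<lambda>r. 0)"
    using True by (auto simp: fun_eq_iff not_less)
  then show ?thesis using True by simp
next
  case False
  then have a: "a > 0" using assms by simp
  define c where "c = a powr (1 / \<gamma>)"
  have c: "c > 0" "c powr \<gamma> = a" using a assms by (auto simp: c_def powr_powr)
  show ?thesis
  proof (cases "\<gamma> > 0")
    case True
    have "(0 < r \<and> r powr \<gamma> < a) = (0 < r \<and> r < c)" for r
      using c True powr_less_mono2[of \<gamma> r c] powr_mono2[of \<gamma> c r] by (auto simp: not_less[symmetric])
    then show ?thesis using nn_integral_powr_lessThan[of c \<gamma>] c True by simp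
  next
    case False
    then have g: "\<gamma> < 0" using assms by simp
    have "(0 < r \<and> r powr \<gamma> < a) = (c < r)" for r
    proof (cases "0 < r")
      case True
      then show ?thesis
        using c g powr_less_mono2_neg[of \<gamma> c r] powr_mono2'[of \<gamma> r c]
        by (auto simp: not_less[symmetric])
    qed (use c in auto)
    then show ?thesis using nn_integral_powr_greaterThan[of c \<gamma>] c g by simp
  qed
qed

section \<open>Surface measure and integration in polar coordinates\<close>

lemma sgn_vec_measurable [measurable]: "(sgn :: real ^ 'n \<Rightarrow> _) \<in> borel_measurable borel"
proof -
  have "(\<lambda>x :: real ^ 'n. x /\<^sub>R norm x) \<in> borel_measurable borel" by measurable
  then show ?thesis by (simp add: sgn_div_norm[abs_def])
qed

lemma sets_borel_surface_measure [measurable_cong]: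
  "sets (borel_surface_measure :: (real ^ 'n) measure) = sets (restrict_space borel (sphere 0 1))"
  by (simp add: borel_surface_measure_def)

lemma space_borel_surface_measure [simp]:
  "space (borel_surface_measure :: (real ^ 'n) measure) = sphere 0 1"
  by (simp add: borel_surface_measure_def space_scale_measure)

lemma borel_measurable_borel_surface_measure:
  assumes "f \<in> borel_measurable borel"
  shows "f \<in> borel_measurable (borel_surface_measure :: (real ^ 'n) measure)"
  using measurable_restrict_space1[OF assms, of "sphere 0 1"]
  by (simp add: measurable_cong_sets[OF sets_borel_surface_measure refl])

lemma nn_integral_borel_surface_measure:
  fixes f :: "real ^ 'n \<Rightarrow> ennreal"
  assumes [measurable]: "f \<in> borel_measurable borel"
  shows "(\<integral>\<^sup>+\<theta>. f \<theta> \<partial>borel_surface_measure) =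
    of_nat CARD('n) * (\<integral>\<^sup>+x. (if 0 < norm x \<and> norm x < 1 then f (sgn x) else 0) \<partial>lborel)"
proof -
  have f: "f \<in> borel_measurable (restrict_space borel (sphere 0 1))"
    by (rule measurable_restrict_space1) measurable
  have "(\<integral>\<^sup>+\<theta>. f \<theta> \<partial>borel_surface_measure) =
      of_nat CARD('n) * (\<integral>\<^sup>+x. f (sgn x) \<partial>restrict_space lborel (ball 0 1 - {0}))"
    unfolding borel_surface_measure_def using f
    by (subst nn_integral_scale_measure)
      (auto simp: nn_integral_distr[OF sgn_measurable_sphere])
  also have "(\<integral>\<^sup>+x. f (sgn x) \<partial>restrict_space lborel (ball 0 1 - {0})) =
      (\<integral>\<^sup>+x. (if 0 < norm x \<and> norm x < 1 then f (sgn x) else 0) \<partial>lborel)"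
    by (subst nn_integral_restrict_space) (auto intro!: nn_integral_cong)
  finally show ?thesis .
qed

text \<open>The total mass is at most \<open>n\<close> times the volume of the unit ball. Finiteness
  makes Fubini available for the product of the sphere and the half line.\<close>

interpretation borel_surface_measure: finite_measure "borel_surface_measure :: (real ^ 'n) measure"
proof
  have "emeasure borel_surface_measure (space (borel_surface_measure :: (real ^ 'n) measure))
      = (\<integral>\<^sup>+\<theta>. 1 \<partial>(borel_surface_measure :: (real ^ 'n) measure))"
    by simp
  also have "\<dots> \<le> of_nat CARD('n) * (\<integral>\<^sup>+x. indicator (ball (0 :: real ^ 'n) 1) x \<partial>lborel)"
    by (subst nn_integral_borel_surface_measure)
      (auto intro!: mult_left_mono nn_integral_mono simp del: nn_integral_indicator
        simp: indicator_def)
  also have "\<dots> < \<infinity>"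
    using emeasure_bounded_finite[of "ball (0 :: real ^ 'n) 1"]
    by (auto simp: ennreal_mult_less_top of_nat_less_top)
  finally show "emeasure borel_surface_measure (space (borel_surface_measure :: (real ^ 'n) measure)) \<noteq> \<infinity>"
    by simp
qed

interpretation surface_lborel:
  pair_sigma_finite "borel_surface_measure :: (real ^ 'n) measure" "lborel :: real measure" ..

text \<open>By the definition of the surface measure, the right-hand side is an integral over the unit
  ball and the half line. Rescaling first \<open>r\<close> and then the point of the ball turns it into
  the integral of \<open>f x\<close> times \<open>n |x|\<^sup>n\<close> times the integral of \<open>r\<^sup>-\<^sup>n\<^sup>-\<^sup>1\<close> over
  \<open>r > |x|\<close>, and these factors cancel.\<close>

theorem nn_integral_polar:
  fixes f :: "real ^ 'n \<Rightarrow> ennreal"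
  assumes [measurable]: "f \<in> borel_measurable borel"
  shows "(\<integral>\<^sup>+x. f x \<partial>lborel) =
    (\<integral>\<^sup>+\<theta>. (\<integral>\<^sup>+r. (if 0 < r then ennreal (r ^ (CARD('n) - 1)) * f (r *\<^sub>R \<theta>) else 0) \<partial>lborel)
      \<partial>borel_surface_measure)"
proof -
  let ?n = "CARD('n)"
  define F where
    "F \<theta> = (\<integral>\<^sup>+r. (if 0 < r then ennreal (r ^ (?n - 1)) * f (r *\<^sub>R \<theta>) else 0) \<partial>lborel)" for \<theta>
  have F[measurable]: "F \<in> borel_measurable borel"
    unfolding F_def by measurable
  have Suc: "r * r ^ (?n - 1) = r ^ ?n" for r :: real
    by (simp add: power_eq_if)
  \<comment> \<open>Replacing \<open>r\<close> by \<open>|y| r\<close> turns the direction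
    \<open>sgn y\<close> back into \<open>y\<close>. The Jacobian \<open>|y|\<close> and the weight
    \<open>|y|^(n-1)\<close> combine to \<open>|y|^n\<close>.\<close>
  have F_sgn: "F (sgn y) =
      (\<integral>\<^sup>+r. (if 0 < r then ennreal (norm y ^ ?n) * ennreal (r ^ (?n - 1)) * f (r *\<^sub>R y) else 0) \<partial>lborel)"
    if "0 < norm y" for y
  proof -
    have *: "F (sgn y) = ennreal (norm y) * (\<integral>\<^sup>+r. (if 0 < norm y * r
        then ennreal ((norm y * r) ^ (?n - 1)) * f ((norm y * r) *\<^sub>R sgn y) else 0) \<partial>lborel)"
      unfolding F_def using that
      by (subst nn_integral_real_affine[where c = "norm y" and t = 0]) (auto cong: if_cong)
    have "ennreal (norm y) * (ennreal ((norm y * r) ^ (?n - 1)) * f ((norm y * r) *\<^sub>R sgn y)) =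
        ennreal (norm y ^ ?n) * ennreal (r ^ (?n - 1)) * f (r *\<^sub>R y)" if "0 < r" for r
    proof -
      have "(norm y * r) *\<^sub>R sgn y = r *\<^sub>R y"
        using \<open>0 < norm y\<close> by (simp add: sgn_div_norm)
      moreover have "ennreal (norm y) * ennreal ((norm y * r) ^ (?n - 1)) =
          ennreal (norm y ^ ?n) * ennreal (r ^ (?n - 1))"
        using that Suc[of "norm y"] by (simp add: ennreal_mult[symmetric] power_mult_distrib)
      ultimately show ?thesis by (metis mult.assoc)
    qed
    then show ?thesis
      unfolding * using that
      by (subst nn_integral_cmult[symmetric], measurable)
        (intro nn_integral_cong, simp add: zero_less_mult_iff)
  qed
  have "(\<integral>\<^sup>+\<theta>. F \<theta> \<partial>borel_surface_measure) =
      of_nat ?n * (\<integral>\<^sup>+y. (if 0 < norm y \<and> norm y < 1 then F (sgn y) else 0) \<partial>lborel)"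
    by (rule nn_integral_borel_surface_measure) measurable
  also have "(\<integral>\<^sup>+y. (if 0 < norm y \<and> norm y < 1 then F (sgn y) else 0) \<partial>lborel) =
      (\<integral>\<^sup>+y. (\<integral>\<^sup>+r. (if 0 < r \<and> 0 < norm y \<and> norm y < 1
        then ennreal (norm y ^ ?n) * ennreal (r ^ (?n - 1)) * f (r *\<^sub>R y) else 0) \<partial>lborel) \<partial>lborel)"
    by (intro nn_integral_cong) (auto simp: F_sgn)
  also have "\<dots> = (\<integral>\<^sup>+r. (\<integral>\<^sup>+y. (if 0 < r \<and> 0 < norm y \<and> norm y < 1
        then ennreal (norm y ^ ?n) * ennreal (r ^ (?n - 1)) * f (r *\<^sub>R y) else 0) \<partial>lborel) \<partial>lborel)"
    by (rule lborel_pair.Fubini') measurable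
  also have "\<dots> = (\<integral>\<^sup>+r. (\<integral>\<^sup>+x. (if 0 < norm x \<and> norm x < r
        then ennreal (norm x ^ ?n) * f x * ennreal (r powr (- real ?n - 1)) else 0) \<partial>lborel) \<partial>lborel)"
  proof (rule nn_integral_cong, goal_cases)
    case (1 r)
    show ?case
    proof (cases "0 < r")
      case True
      \<comment> \<open>The three factors are the Jacobian of \<open>y = x / r\<close>, the power of
        \<open>r\<close> released by \<open>norm y ^ n\<close>, and the polar weight.\<close>
      have pw: "r powr (- real ?n - 1) = (1 / r) ^ ?n * ((1 / r) ^ ?n * r ^ (?n - 1))"
        using True Suc[of r]
        by (simp add: powr_diff powr_minus powr_realpow field_simps)
      have "ennreal ((1 / r) ^ ?n) * (ennreal (norm (x /\<^sub>R r) ^ ?n) * ennreal (r ^ (?n - 1)))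
        = ennreal (norm x ^ ?n) * ennreal (r powr (- real ?n - 1))" for x :: "real ^ 'n"
        unfolding pw using True
        by (simp add: ennreal_mult[symmetric] power_mult_distrib field_simps)
      then have "ennreal ((1 / r) ^ ?n) * (ennreal (norm (x /\<^sub>R r) ^ ?n) * ennreal (r ^ (?n - 1))) * f x
        = ennreal (norm x ^ ?n) * ennreal (r powr (- real ?n - 1)) * f x" for x
        by (simp only:)
      then have eq: "ennreal ((1 / r) ^ ?n) * (ennreal (norm (x /\<^sub>R r) ^ ?n) * ennreal (r ^ (?n - 1)) * f x)
        = ennreal (norm x ^ ?n) * f x * ennreal (r powr (- real ?n - 1))" for x
        by (simp only: mult.assoc mult.commute[of "f x"])
      have "(\<integral>\<^sup>+y. (if 0 < r \<and> 0 < norm y \<and> norm y < 1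
          then ennreal (norm y ^ ?n) * ennreal (r ^ (?n - 1)) * f (r *\<^sub>R y) else 0) \<partial>lborel)
        = ennreal ((1 / r) ^ DIM(real ^ 'n)) * (\<integral>\<^sup>+x. (if 0 < r \<and> 0 < norm ((1 / r) *\<^sub>R x) \<and> norm ((1 / r) *\<^sub>R x) < 1
          then ennreal (norm ((1 / r) *\<^sub>R x) ^ ?n) * ennreal (r ^ (?n - 1)) * f (r *\<^sub>R (1 / r) *\<^sub>R x) else 0) \<partial>lborel)"
        using True by (intro nn_integral_lborel_scaleR) auto
      also have "\<dots> = ennreal ((1 / r) ^ ?n) * (\<integral>\<^sup>+x. (if 0 < norm x \<and> norm x < r
          then ennreal (norm (x /\<^sub>R r) ^ ?n) * ennreal (r ^ (?n - 1)) * f x else 0) \<partial>lborel)"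
      proof -
        have "(1 / r) *\<^sub>R x = x /\<^sub>R r" "r *\<^sub>R (x /\<^sub>R r) = x" "0 < norm (x /\<^sub>R r) \<longleftrightarrow> 0 < norm x"
          "norm (x /\<^sub>R r) < 1 \<longleftrightarrow> norm x < r" for x :: "real ^ 'n"
          using True by (auto simp: inverse_eq_divide)
        then show ?thesis
          using True by (simp only: DIM_cart DIM_real mult_1_right simp_thms)
      qed
      also have "\<dots> = (\<integral>\<^sup>+x. ennreal ((1 / r) ^ ?n) * (if 0 < norm x \<and> norm x < r
          then ennreal (norm (x /\<^sub>R r) ^ ?n) * ennreal (r ^ (?n - 1)) * f x else 0) \<partial>lborel)"
        by (rule nn_integral_cmult[symmetric]) measurable
      also have "\<dots> = (\<integral>\<^sup>+x. (if 0 < norm x \<and> norm x < r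
          then ennreal (norm x ^ ?n) * f x * ennreal (r powr (- real ?n - 1)) else 0) \<partial>lborel)"
      proof (rule nn_integral_cong)
        fix x :: "real ^ 'n"
        show "ennreal ((1 / r) ^ ?n) * (if 0 < norm x \<and> norm x < r
            then ennreal (norm (x /\<^sub>R r) ^ ?n) * ennreal (r ^ (?n - 1)) * f x else 0) =
          (if 0 < norm x \<and> norm x < r
            then ennreal (norm x ^ ?n) * f x * ennreal (r powr (- real ?n - 1)) else 0)"
          using eq[of x] by (simp only: if_distrib[of "(*) _"] mult_zero_right)
      qed
      finally show ?thesis .
    next
      case False
      then have "\<not> (0 < norm x \<and> norm x < r)" for x :: "real ^ 'n"
        using order.strict_trans by blast
      with False show ?thesis by (simp only: simp_thms if_False)
    qed
  qed
  also have "\<dots> = (\<integral>\<^sup>+x. (\<integral>\<^sup>+r. (if 0 < norm x \<and> norm x < r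
        then ennreal (norm x ^ ?n) * f x * ennreal (r powr (- real ?n - 1)) else 0) \<partial>lborel) \<partial>lborel)"
    by (rule lborel_pair.Fubini') measurable
  also have "\<dots> = (\<integral>\<^sup>+x. ennreal (1 / real ?n) * f x \<partial>lborel)"
  proof (rule nn_integral_cong_AE, rule eventually_mono[OF AE_lborel_singleton[of 0]], goal_cases)
    case (1 x)
    have "(\<integral>\<^sup>+r. (if 0 < norm x \<and> norm x < r
        then ennreal (norm x ^ ?n) * f x * ennreal (r powr (- real ?n - 1)) else 0) \<partial>lborel)
      = (\<integral>\<^sup>+r. ennreal (norm x ^ ?n) * f x * (if norm x < r then ennreal (r powr (- real ?n - 1)) else 0) \<partial>lborel)"
      using 1 by (intro nn_integral_cong) auto
    also have "\<dots> = ennreal (norm x ^ ?n) * f x * ennreal (norm x powr (- real ?n) / real ?n)"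
      using 1 nn_integral_powr_greaterThan[of "norm x" "- real ?n"]
      by (subst nn_integral_cmult) auto
    also have "\<dots> = ennreal (norm x ^ ?n * (norm x powr (- real ?n) / real ?n)) * f x"
    proof -
      have "ennreal (norm x ^ ?n * (norm x powr (- real ?n) / real ?n)) =
          ennreal (norm x ^ ?n) * ennreal (norm x powr (- real ?n) / real ?n)"
        by (rule ennreal_mult) auto
      then show ?thesis by (simp only: mult.assoc mult.commute[of "f x"])
    qed
    also have "norm x ^ ?n * (norm x powr (- real ?n) / real ?n) = 1 / real ?n"
      using 1 by (simp add: powr_minus powr_realpow field_simps)
    finally show ?case .
  qed
  also have "of_nat ?n * \<dots> = (ennreal (real ?n) * ennreal (1 / real ?n)) * (\<integral>\<^sup>+x. f x \<partial>lborel)"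
    by (subst nn_integral_cmult) (auto simp: mult.assoc ennreal_of_nat_eq_real_of_nat)
  also have "ennreal (real ?n) * ennreal (1 / real ?n) = 1"
    by (simp add: ennreal_mult[symmetric])
  finally show ?thesis by (simp add: F_def)
qed

section \<open>Null sets in polar coordinates\<close>

text \<open>The polar integral of the indicator of \<open>N\<close> vanishes iff its inner integral
  vanishes almost everywhere, and the weight \<open>r^(n-1)\<close> is positive for
  \<open>r > 0\<close>. The two equivalences correspond to the two orders of integration. The first
  suits sets examined ray by ray, the second those examined sphere by sphere.\<close>

lemma AE_lborel_polar_iff:
  fixes N :: "(real ^ 'n) set"
  assumes [measurable]: "N \<in> sets borel"
  shows "(AE x in lborel. x \<notin> N) \<longleftrightarrow> (AE \<theta> in borel_surface_measure. AE r in lborel. 0 < r \<longrightarrow> r *\<^sub>R \<theta> \<notin> N)"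
    and "(AE x in lborel. x \<notin> N) \<longleftrightarrow> (AE r in lborel. 0 < r \<longrightarrow> (AE \<theta> in borel_surface_measure. r *\<^sub>R \<theta> \<notin> N))"
proof -
  define f where "f \<theta> r = (if 0 < r then ennreal (r ^ (CARD('n) - 1)) * indicator N (r *\<^sub>R \<theta>) else 0)"
    for \<theta> :: "real ^ 'n" and r
  have meas: "case_prod f \<in> borel_measurable (borel \<Otimes>\<^sub>M borel)"
    unfolding f_def by measurable
  \<comment> \<open>The surface measure carries only the trace of the Borel sets on the sphere, so
    joint measurability is shown on the whole space and pulled back along the inclusion.\<close>
  have "(\<lambda>\<theta>. \<theta>) \<in> borel_measurable (borel_surface_measure :: (real ^ 'n) measure)"
    by (rule borel_measurable_borel_surface_measure) simp
  then have "(\<lambda>p. (fst p, snd p)) \<in>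
      (borel_surface_measure :: (real ^ 'n) measure) \<Otimes>\<^sub>M (lborel :: real measure) \<rightarrow>\<^sub>M borel \<Otimes>\<^sub>M borel"
    by (intro measurable_Pair measurable_compose[OF measurable_fst]) auto
  from measurable_compose[OF this meas] have [measurable]:
      "case_prod f \<in> borel_measurable ((borel_surface_measure :: (real ^ 'n) measure) \<Otimes>\<^sub>M (lborel :: real measure))"
    by simp
  have pos: "f \<theta> r = 0 \<longleftrightarrow> (0 < r \<longrightarrow> r *\<^sub>R \<theta> \<notin> N)" for \<theta> r
    by (auto simp: f_def indicator_def)
  have polar: "(\<integral>\<^sup>+x. indicator N x \<partial>lborel) = (\<integral>\<^sup>+\<theta>. (\<integral>\<^sup>+r. f \<theta> r \<partial>lborel) \<partial>borel_surface_measure)"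
    unfolding f_def by (rule nn_integral_polar) measurable
  also have "\<dots> = 0 \<longleftrightarrow> (AE \<theta> in borel_surface_measure. AE r in lborel. f \<theta> r = 0)"
    by (subst nn_integral_0_iff_AE, measurable) (auto simp: nn_integral_0_iff_AE)
  finally show "(AE x in lborel. x \<notin> N) \<longleftrightarrow> (AE \<theta> in borel_surface_measure. AE r in lborel. 0 < r \<longrightarrow> r *\<^sub>R \<theta> \<notin> N)"
    by (simp only: pos) (simp add: nn_integral_0_iff_AE indicator_eq_0_iff del: nn_integral_indicator)
  have "(\<integral>\<^sup>+x. indicator N x \<partial>lborel) = (\<integral>\<^sup>+r. (\<integral>\<^sup>+\<theta>. f \<theta> r \<partial>borel_surface_measure) \<partial>lborel)"
    unfolding polar by (rule surface_lborel.Fubini'[symmetric]) measurable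
  also have "\<dots> = 0 \<longleftrightarrow> (AE r in lborel. AE \<theta> in borel_surface_measure. f \<theta> r = 0)"
    by (subst nn_integral_0_iff_AE, measurable) (auto simp: nn_integral_0_iff_AE)
  finally show "(AE x in lborel. x \<notin> N) \<longleftrightarrow> (AE r in lborel. 0 < r \<longrightarrow> (AE \<theta> in borel_surface_measure. r *\<^sub>R \<theta> \<notin> N))"
    by (simp only: pos) (simp add: nn_integral_0_iff_AE indicator_eq_0_iff del: nn_integral_indicator)
qed

text \<open>Here \<open>P\<close> may be non-measurable, so its exceptional set is first enclosed in
  a Borel null set.\<close>

lemma AE_lborel_imp_AE_spheres:
  fixes P :: "real ^ 'n \<Rightarrow> bool"
  assumes "AE x in lborel. P x"
  shows "AE r in lborel. 0 < r \<longrightarrow> (AE \<theta> in borel_surface_measure. P (r *\<^sub>R \<theta>))"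
proof -
  obtain N where N: "\<And>x. x \<notin> N \<Longrightarrow> P x" "N \<in> null_sets lborel"
    using AE_E3[OF assms(1)] by auto
  then have "AE x in lborel. x \<notin> N" by (intro AE_not_in)
  then have "AE r in lborel. 0 < r \<longrightarrow> (AE \<theta> in borel_surface_measure. r *\<^sub>R \<theta> \<notin> N)"
    using N(2) by (subst (asm) AE_lborel_polar_iff(2)) auto
  then show ?thesis
    by (rule eventually_mono) (auto elim!: eventually_mono intro: N(1))
qed

text \<open>The cone over a null set of directions is a null set of the space, as almost every ray
  misses it entirely.\<close>

lemma AE_lborel_sgn:
  fixes P :: "real ^ 'n \<Rightarrow> bool"
  assumes "AE \<theta> in borel_surface_measure. P \<theta>"
  shows "AE x in lborel. P (sgn x)"
proof -
  obtain N where N: "\<And>\<theta>. \<theta> \<in> sphere 0 1 - N \<Longrightarrow> P \<theta>" "N \<in> null_sets borel_surface_measure"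
    using AE_E3[OF assms] by (metis space_borel_surface_measure)
  have [measurable]: "N \<in> sets borel"
    using N(2) by (auto simp: null_sets_def sets_borel_surface_measure sets_restrict_space_iff)
  define M where "M = {x :: real ^ 'n. x \<noteq> 0 \<and> sgn x \<in> N}"
  have [measurable]: "M \<in> sets borel" unfolding M_def by measurable
  have "AE \<theta> in borel_surface_measure. AE r in lborel. 0 < r \<longrightarrow> r *\<^sub>R \<theta> \<notin> M"
    using AE_not_in[OF N(2)] AE_space
  proof eventually_elim
    case (elim \<theta>)
    then show ?case by (intro AE_I2) (auto simp: M_def sgn_div_norm)
  qed
  then have "AE x in lborel. x \<notin> M" by (subst AE_lborel_polar_iff(1)) auto
  then show ?thesis
    using AE_lborel_singleton[of 0]
    by eventually_elim (auto simp: M_def norm_sgn intro!: N(1))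
qed

text \<open>Dilation multiplies the measure of a null set by a finite positive factor. This carries
  almost everywhere statements over to the dilated variable.\<close>

lemma AE_lborel_scaleR:
  fixes P :: "'a::euclidean_space \<Rightarrow> bool"
  assumes "AE x in lborel. P x" and "c > 0"
  shows "AE x in lborel. P (c *\<^sub>R x)"
proof -
  obtain N where N: "\<And>x. x \<notin> N \<Longrightarrow> P x" "N \<in> null_sets lborel"
    using AE_E3[OF assms(1)] by auto
  then have [measurable]: "N \<in> sets borel" by auto
  have "0 = ennreal (c ^ DIM('a)) * (\<integral>\<^sup>+x. indicator N (c *\<^sub>R x) \<partial>lborel)"
    using nn_integral_lborel_scaleR[of "indicator N" c] null_setsD1[OF N(2)] \<open>c > 0\<close>
    by simp
  then have "(\<integral>\<^sup>+x. indicator N (c *\<^sub>R x) \<partial>(lborel :: 'a measure)) = 0"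
    using zero_less_power[OF \<open>c > 0\<close>, of "DIM('a)"] by (auto simp: ennreal_eq_0_iff)
  then have "AE x in lborel. (indicator N (c *\<^sub>R x) :: ennreal) = 0"
    by (subst (asm) nn_integral_0_iff_AE) auto
  then show ?thesis by eventually_elim (auto intro: N(1) simp: indicator_eq_0_iff)
qed

section \<open>Weighted measure of radial superlevel sets\<close>

text \<open>The polar weight \<open>r^(n-1)\<close> reduces the exponent \<open>\<gamma> - n\<close>
  to \<open>\<gamma> - 1\<close>, and each ray then contributes the one-dimensional superlevel
  integral with \<open>a = B \<theta>\<close>. Taking \<open>B = A\<close> evaluates the limit;
  taking \<open>B = G\<close> shows that the majorant has finite integral.\<close>

lemma nn_integral_radial_superlevel:
  fixes B :: "real ^ 'n \<Rightarrow> real"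
  assumes [measurable]: "B \<in> borel_measurable borel" and "\<And>\<theta>. 0 \<le> B \<theta>" "\<gamma> \<noteq> 0"
  shows "(\<integral>\<^sup>+x. (if norm x powr \<gamma> < B (sgn x) then ennreal (norm x powr (\<gamma> - real CARD('n))) else 0) \<partial>lborel)
    = ennreal (1 / \<bar>\<gamma>\<bar>) * (\<integral>\<^sup>+\<theta>. ennreal (B \<theta>) \<partial>borel_surface_measure)"
proof -
  let ?n = "CARD('n)"
  have "(\<integral>\<^sup>+x. (if norm x powr \<gamma> < B (sgn x) then ennreal (norm x powr (\<gamma> - real ?n)) else 0) \<partial>lborel)
    = (\<integral>\<^sup>+\<theta>. (\<integral>\<^sup>+r. (if 0 < r then ennreal (r ^ (?n - 1)) *
        (if norm (r *\<^sub>R \<theta>) powr \<gamma> < B (sgn (r *\<^sub>R \<theta>))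
          then ennreal (norm (r *\<^sub>R \<theta>) powr (\<gamma> - real ?n)) else 0) else 0) \<partial>lborel)
      \<partial>borel_surface_measure)"
    by (rule nn_integral_polar) measurable
  also have "\<dots> = (\<integral>\<^sup>+\<theta>. ennreal (1 / \<bar>\<gamma>\<bar>) * ennreal (B \<theta>) \<partial>borel_surface_measure)"
  proof (rule nn_integral_cong, goal_cases)
    case (1 \<theta>)
    then have \<theta>: "norm \<theta> = 1" by simp
    have *: "r ^ (?n - 1) * r powr (\<gamma> - real ?n) = r powr (\<gamma> - 1)" if "0 < r" for r
      using that by (simp add: powr_realpow[symmetric] powr_add[symmetric] of_nat_diff)
    have "(if 0 < r then ennreal (r ^ (?n - 1)) *
        (if norm (r *\<^sub>R \<theta>) powr \<gamma> < B (sgn (r *\<^sub>R \<theta>))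
          then ennreal (norm (r *\<^sub>R \<theta>) powr (\<gamma> - real ?n)) else 0) else 0) =
      (if 0 < r \<and> r powr \<gamma> < B \<theta> then ennreal (r powr (\<gamma> - 1)) else 0)" for r
      using \<theta> by (auto simp: sgn_div_norm ennreal_mult[symmetric] simp flip: *)
    then show ?case
      using nn_integral_powr_superlevel[of "B \<theta>" \<gamma>] assms
      by (simp add: ennreal_mult[symmetric])
  qed
  also have "\<dots> = ennreal (1 / \<bar>\<gamma>\<bar>) * (\<integral>\<^sup>+\<theta>. ennreal (B \<theta>) \<partial>borel_surface_measure)"
    by (intro nn_integral_cmult borel_measurable_borel_surface_measure) measurable
  finally show ?thesis .
qed

text \<open>Each ray meets the set of equality in at most one point. On this set the convergence of
  the level sets could fail, so it has to be null.\<close>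

lemma AE_norm_powr_neq:
  fixes B :: "real ^ 'n \<Rightarrow> real"
  assumes [measurable]: "B \<in> borel_measurable borel" and "\<gamma> \<noteq> 0"
  shows "AE x in lborel. norm x powr \<gamma> \<noteq> B (sgn x)"
proof -
  define N where "N = {x. x \<noteq> 0 \<and> norm x powr \<gamma> = B (sgn x)}"
  have [measurable]: "N \<in> sets borel" unfolding N_def by measurable
  have "AE \<theta> in borel_surface_measure. AE r in lborel. 0 < r \<longrightarrow> r *\<^sub>R \<theta> \<notin> N"
  proof (rule AE_I2)
    fix \<theta> :: "real ^ 'n" assume "\<theta> \<in> space borel_surface_measure"
    then have \<theta>: "norm \<theta> = 1" by simp
    show "AE r in lborel. 0 < r \<longrightarrow> r *\<^sub>R \<theta> \<notin> N"
      using AE_lborel_singleton[of "B \<theta> powr (1 / \<gamma>)"]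
    proof eventually_elim
      case (elim r)
      then show ?case using \<theta> \<open>\<gamma> \<noteq> 0\<close>
        by (auto simp: N_def sgn_div_norm powr_powr dest!: sym[of _ "B \<theta>"])
    qed
  qed
  then have "AE x in lborel. x \<notin> N" by (subst AE_lborel_polar_iff(1)) auto
  then show ?thesis
    using AE_lborel_singleton[of 0] by eventually_elim (auto simp: N_def)
qed

section \<open>The limit along sequences for Borel data\<close>

lemma filterlim_powr_at_top:
  fixes f :: "'a \<Rightarrow> real" and p :: real
  assumes "filterlim f at_top F" "0 < p"
  shows "filterlim (\<lambda>x. f x powr p) at_top F"
proof (rule filterlim_cong[THEN iffD1])
  show "filterlim (\<lambda>x. exp (p * ln (f x))) at_top F"
    using assms
    by (intro filterlim_compose[OF exp_at_top] filterlim_compose[OF ln_at_top]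
        filterlim_tendsto_pos_mult_at_top[OF tendsto_const])
  show "eventually (\<lambda>x. exp (p * ln (f x)) = f x powr p) F"
    using filterlim_at_top_dense[THEN iffD1, OF assms(1), rule_format, of 0]
    by eventually_elim (simp add: powr_def)
qed auto

text \<open>Here \<open>h\<close> stands for a Borel version of the modulus of the given function.
  The radial bound and the radial limit enter as statements about almost every point of the space,
  which is the form needed for dominated convergence after the dilation.\<close>

proposition weighted_level_set_tendsto:
  fixes h G A :: "real ^ 'n \<Rightarrow> real" and \<gamma> R :: real and t :: "nat \<Rightarrow> real"
  assumes [measurable]: "h \<in> borel_measurable borel" "G \<in> borel_measurable borel" "A \<in> borel_measurable borel"
    and h0: "\<And>x. 0 \<le> h x" and G0: "\<And>x. 0 \<le> G x" and A0: "\<And>x. 0 \<le> A x"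
    and \<gamma>: "\<gamma> \<noteq> 0" and R: "0 < R"
    and inner: "(\<integral>\<^sup>+x. (if norm x < R then ennreal (h x) else 0) \<partial>lborel) < \<infinity>"
    and dom: "AE x in lborel. R \<le> norm x \<longrightarrow> norm x ^ CARD('n) * h x \<le> G (sgn x)"
    and G: "(\<integral>\<^sup>+\<theta>. ennreal (G \<theta>) \<partial>borel_surface_measure) < \<infinity>"
    and t0: "\<And>k. 0 < t k" and t: "filterlim t at_top sequentially"
    and lim: "AE x in lborel. (\<lambda>k. norm (t k *\<^sub>R x) ^ CARD('n) * h (t k *\<^sub>R x)) \<longlonglongrightarrow> A (sgn x)"
  shows "(\<lambda>k. ennreal (t k powr - \<gamma>) * (\<integral>\<^sup>+x. (if t k powr - \<gamma> < h x / norm x powr (\<gamma> - real CARD('n))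
        then ennreal (norm x powr (\<gamma> - real CARD('n))) else 0) \<partial>lborel))
    \<longlonglongrightarrow> ennreal (1 / \<bar>\<gamma>\<bar>) * (\<integral>\<^sup>+\<theta>. ennreal (A \<theta>) \<partial>borel_surface_measure)"
proof -
  let ?n = "CARD('n)"
  define s where "s k = t k powr - \<gamma>" for k
  have s0: "0 < s k" for k using t0[of k] by (simp add: s_def)
  define w where "w x = norm x powr (\<gamma> - real ?n)" for x :: "real ^ 'n"
  have [measurable]: "w \<in> borel_measurable borel" unfolding w_def by measurable
  have w0: "0 \<le> w x" for x by (simp add: w_def)
  have w_pos: "0 < w x" if "x \<noteq> 0" for x using that by (simp add: w_def)
  define I where "I k x = (if norm x < R \<and> s k < h x / w x then ennreal (s k * w x) else 0)" for k x
  define J where "J k x = (if R \<le> norm x \<and> s k < h x / w x then ennreal (s k * w x) else 0)" for k x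
  have [measurable]: "I k \<in> borel_measurable borel" "J k \<in> borel_measurable borel" for k
    unfolding I_def J_def by measurable
  have level: "s k < h x / w x \<longleftrightarrow> s k * w x < h x" if "x \<noteq> 0" for k x
    using w_pos[OF that] by (rule pos_less_divide_eq)
  have split: "ennreal (s k) * (\<integral>\<^sup>+x. (if s k < h x / w x then ennreal (w x) else 0) \<partial>lborel)
      = (\<integral>\<^sup>+x. I k x \<partial>lborel) + (\<integral>\<^sup>+x. J k x \<partial>lborel)" for k
  proof -
    have "ennreal (s k) * (\<integral>\<^sup>+x. (if s k < h x / w x then ennreal (w x) else 0) \<partial>lborel)
        = (\<integral>\<^sup>+x. ennreal (s k) * (if s k < h x / w x then ennreal (w x) else 0) \<partial>lborel)"
      by (rule nn_integral_cmult[symmetric]) measurable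
    also have "\<dots> = (\<integral>\<^sup>+x. I k x + J k x \<partial>lborel)"
      using s0[of k] w0 by (intro nn_integral_cong) (auto simp: I_def J_def ennreal_mult)
    also have "\<dots> = (\<integral>\<^sup>+x. I k x \<partial>lborel) + (\<integral>\<^sup>+x. J k x \<partial>lborel)"
      by (rule nn_integral_add) measurable
    finally show ?thesis .
  qed

  have I: "(\<lambda>k. \<integral>\<^sup>+x. I k x \<partial>lborel) \<longlonglongrightarrow> (\<integral>\<^sup>+(x :: real ^ 'n). 0 \<partial>lborel)"
  proof (rule nn_integral_dominated_convergence)
    show "AE x in lborel. I k x \<le> (if norm x < R then ennreal (h x) else 0)" for k
      using AE_lborel_singleton[of 0]
    proof eventually_elim
      case (elim x)
      then show ?case using level[of x k] by (auto simp: I_def intro!: ennreal_leI)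
    qed
    show "AE x in lborel. (\<lambda>k. I k x) \<longlonglongrightarrow> 0"
      using AE_lborel_singleton[of 0]
    proof eventually_elim
      case (elim x)
      show ?case
      \<comment> \<open>For a positive exponent \<open>s k\<close> tends to \<open>0\<close> and
        squeezes the integrand. For a negative one \<open>s k\<close> tends to infinity, and at each
        fixed point the level set condition eventually fails.\<close>
      proof (cases "0 < \<gamma>")
        case True
        then have "(\<lambda>k. t k powr - \<gamma>) \<longlonglongrightarrow> 0"
          using t by (intro tendsto_neg_powr) auto
        then have "(\<lambda>k. ennreal (s k * w x)) \<longlonglongrightarrow> ennreal (0 * w x)"
          unfolding s_def by (intro tendsto_intros)
        then have *: "(\<lambda>k. ennreal (s k * w x)) \<longlonglongrightarrow> 0" by simp
        show ?thesis
          by (rule tendsto_sandwich[OF _ _ tendsto_const *]) (auto simp: I_def)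
      next
        case False
        then have "filterlim (\<lambda>k. t k powr - \<gamma>) at_top sequentially"
          using \<gamma> by (intro filterlim_powr_at_top t) auto
        then have "eventually (\<lambda>k. h x / w x \<le> s k) sequentially"
          unfolding s_def by (simp add: filterlim_at_top)
        then have "eventually (\<lambda>k. I k x = 0) sequentially"
          by eventually_elim (auto simp: I_def)
        then show ?thesis by (rule tendsto_eventually)
      qed
    qed
  qed (use inner in auto)

  \<comment> \<open>This is the outer integrand after the dilation. The powers of \<open>t k\<close>
    cancel: the Jacobian, \<open>s k\<close> and the weight contribute the exponents
    \<open>n\<close>, \<open>-\<gamma>\<close> and \<open>\<gamma> - n\<close>, which add up to
    \<open>0\<close>. The level set condition is multiplied by
    \<open>norm (t k *\<^sub>R y) ^ n\<close>, which makes its left-hand side independent of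
    \<open>k\<close>.\<close>
  define u where "u k y = (if R \<le> norm (t k *\<^sub>R y) \<and> norm y powr \<gamma> < norm (t k *\<^sub>R y) ^ ?n * h (t k *\<^sub>R y)
    then ennreal (w y) else 0)" for k y
  have [measurable]: "u k \<in> borel_measurable borel" for k unfolding u_def by measurable
  have J_eq: "(\<integral>\<^sup>+x. J k x \<partial>lborel) = (\<integral>\<^sup>+y. u k y \<partial>lborel)" for k
  proof -
    have *: "ennreal (t k ^ ?n) * J k (t k *\<^sub>R y) = u k y" if "y \<noteq> 0" for y
    proof -
      have tw: "t k ^ ?n * (s k * w (t k *\<^sub>R y)) = w y"
        using t0[of k] that
        by (simp add: s_def w_def powr_mult powr_diff powr_minus powr_realpow field_simps)
      have nw: "norm y powr \<gamma> = norm (t k *\<^sub>R y) ^ ?n * (s k * w (t k *\<^sub>R y))"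
        using t0[of k] that
        by (simp add: s_def w_def powr_mult powr_diff powr_minus powr_realpow field_simps)
      have ty: "t k *\<^sub>R y \<noteq> 0" using t0[of k] that by simp
      then have "norm y powr \<gamma> < norm (t k *\<^sub>R y) ^ ?n * h (t k *\<^sub>R y) \<longleftrightarrow> s k < h (t k *\<^sub>R y) / w (t k *\<^sub>R y)"
        unfolding level[OF ty] nw
        by (intro mult_less_cancel_left_pos zero_less_power) (simp only: zero_less_norm_iff not_False_eq_True)
      then show ?thesis
        using tw t0[of k] s0[of k] w0[of "t k *\<^sub>R y"]
        by (auto simp: J_def u_def ennreal_mult[symmetric])
    qed
    have "(\<integral>\<^sup>+x. J k x \<partial>lborel) = ennreal (t k ^ ?n) * (\<integral>\<^sup>+y. J k (t k *\<^sub>R y) \<partial>lborel)"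
      using t0[of k] by (subst nn_integral_lborel_scaleR[of _ "t k"]) auto
    also have "\<dots> = (\<integral>\<^sup>+y. ennreal (t k ^ ?n) * J k (t k *\<^sub>R y) \<partial>lborel)"
      by (rule nn_integral_cmult[symmetric]) measurable
    also have "\<dots> = (\<integral>\<^sup>+y. u k y \<partial>lborel)"
      by (intro nn_integral_cong_AE eventually_mono[OF AE_lborel_singleton[of 0]] *)
    finally show ?thesis .
  qed
  have J: "(\<lambda>k. \<integral>\<^sup>+y. u k y \<partial>lborel) \<longlonglongrightarrow>
      (\<integral>\<^sup>+y. (if norm y powr \<gamma> < A (sgn y) then ennreal (w y) else 0) \<partial>lborel)"
  proof (rule nn_integral_dominated_convergence)
    show "(\<integral>\<^sup>+y. (if norm y powr \<gamma> < G (sgn y) then ennreal (w y) else 0) \<partial>lborel) < \<infinity>"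
      unfolding w_def using G0 \<gamma> G
      by (subst nn_integral_radial_superlevel) (auto simp: ennreal_mult_less_top)
    \<comment> \<open>One majorant serves all \<open>k\<close>, because the direction
      \<open>sgn y\<close> is unchanged by dilations.\<close>
    show "AE y in lborel. u k y \<le> (if norm y powr \<gamma> < G (sgn y) then ennreal (w y) else 0)" for k
      using AE_lborel_scaleR[OF dom t0[of k]]
    proof eventually_elim
      case (elim y)
      have "sgn (t k *\<^sub>R y) = sgn y" using t0[of k] by (simp add: sgn_scaleR)
      then show ?case using elim by (auto simp: u_def)
    qed
    \<comment> \<open>Away from equality, the strict inequality between
      \<open>norm y powr \<gamma>\<close> and the limit \<open>A (sgn y)\<close> passes to all large
      \<open>k\<close>, so \<open>u k y\<close> is eventually constant.\<close>
    show "AE y in lborel. (\<lambda>k. u k y) \<longlonglongrightarrow> (if norm y powr \<gamma> < A (sgn y) then ennreal (w y) else 0)"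
      using lim AE_norm_powr_neq[OF \<open>A \<in> borel_measurable borel\<close> \<gamma>] AE_lborel_singleton[of 0]
    proof eventually_elim
      case (elim y)
      have "filterlim (\<lambda>k. t k * norm y) at_top sequentially"
        using elim t by (intro filterlim_at_top_mult_tendsto_pos[OF tendsto_const]) auto
      then have "eventually (\<lambda>k. R \<le> t k * norm y) sequentially"
        by (simp add: filterlim_at_top)
      then have large: "eventually (\<lambda>k. R \<le> norm (t k *\<^sub>R y)) sequentially"
        using t0 by (simp add: abs_of_pos)
      show ?case
      proof (cases "norm y powr \<gamma> < A (sgn y)")
        case True
        have "eventually (\<lambda>k. u k y = ennreal (w y)) sequentially"
          using order_tendstoD(1)[OF elim(1) True] large by eventually_elim (simp add: u_def)
        then show ?thesis using True by (simp add: tendsto_eventually)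
      next
        case False
        then have *: "A (sgn y) < norm y powr \<gamma>" using elim(2) by simp
        have "eventually (\<lambda>k. u k y = 0) sequentially"
          using order_tendstoD(2)[OF elim(1) *] by eventually_elim (simp add: u_def)
        then show ?thesis using False by (simp add: tendsto_eventually)
      qed
    qed
  qed measurable
  have "(\<lambda>k. ennreal (s k) * (\<integral>\<^sup>+x. (if s k < h x / w x then ennreal (w x) else 0) \<partial>lborel)) \<longlonglongrightarrow>
      0 + (\<integral>\<^sup>+y. (if norm y powr \<gamma> < A (sgn y) then ennreal (w y) else 0) \<partial>lborel)"
    unfolding split J_eq using I J by (intro tendsto_add) auto
  then show ?thesis
    unfolding s_def w_def using nn_integral_radial_superlevel[of A \<gamma>] A0 \<gamma> by simp
qed

section \<open>Borel versions and auxiliary facts on measurability\<close>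

text \<open>Preimages under \<open>f\<close> and \<open>g\<close> differ by a null set, which the
  completion absorbs. The lemma is meant for \<open>radial_limit\<close>, whose value is unspecified
  where no limit exists.\<close>

lemma borel_measurable_surface_measure_AE:
  fixes f g :: "real ^ 'n \<Rightarrow> real"
  assumes [measurable]: "g \<in> borel_measurable borel_surface_measure"
    and eq: "AE \<theta> in borel_surface_measure. f \<theta> = g \<theta>"
  shows "f \<in> borel_measurable surface_measure"
proof (rule measurableI)
  fix B :: "real set" assume [measurable]: "B \<in> sets borel"
  have g: "g -` B \<inter> space borel_surface_measure \<in> sets (completion borel_surface_measure)"
    by (intro sets_completionI_sets) measurable
  have "AE x in completion borel_surface_measure.
      x \<in> g -` B \<inter> space borel_surface_measure \<longleftrightarrow> x \<in> f -` B \<inter> space borel_surface_measure"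
    using eq unfolding AE_completion_iff by eventually_elim auto
  from completion.in_sets_AE[OF this g]
  show "f -` B \<inter> space surface_measure \<in> sets surface_measure"
    by (simp add: surface_measure_def)
qed simp

text \<open>Extension by \<open>0\<close> off the sphere yields a function that is Borel on the
  whole space and can be composed with \<open>sgn\<close>.\<close>

lemma surface_measurable_borel_version:
  fixes f :: "real ^ 'n \<Rightarrow> real"
  assumes "f \<in> borel_measurable surface_measure"
  obtains g where "g \<in> borel_measurable borel" "AE \<theta> in borel_surface_measure. f \<theta> = g \<theta>"
proof -
  obtain g where g: "g \<in> borel_measurable borel_surface_measure" "AE \<theta> in borel_surface_measure. f \<theta> = g \<theta>"
    using completion_ex_borel_measurable_real[OF assms[unfolded surface_measure_def]] by blast
  show thesis
  proof
    show "(\<lambda>\<theta>. if \<theta> \<in> sphere 0 1 then g \<theta> else 0) \<in> borel_measurable borel"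
      using g(1) by (subst measurable_restrict_space_iff[symmetric])
        (auto simp: measurable_cong_sets[OF sets_borel_surface_measure refl])
    show "AE \<theta> in borel_surface_measure. f \<theta> = (if \<theta> \<in> sphere 0 1 then g \<theta> else 0)"
      using g(2) AE_space by eventually_elim auto
  qed
qed

text \<open>The ball has finite measure, so an essential bound suffices for infinite
  \<open>p\<close>, and \<open>y \<le> 1 + y powr q\<close> suffices for finite
  \<open>p\<close>.\<close>

lemma in_Lp_nn_integral_finite:
  fixes g :: "real ^ 'n \<Rightarrow> complex"
  assumes "in_Lp p (ball 0 R) g" "1 \<le> p"
  shows "(\<integral>\<^sup>+x. ennreal (norm (g x)) \<partial>lebesgue_on (ball 0 R)) < \<infinity>"
proof -
  let ?M = "lebesgue_on (ball (0 :: real ^ 'n) R)"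
  have [measurable]: "g \<in> borel_measurable ?M" using assms(1) by (simp add: in_Lp_def)
  have "emeasure lborel (ball (0 :: real ^ 'n) R) < \<infinity>"
    by (intro emeasure_bounded_finite) simp
  then have fin: "emeasure ?M (space ?M) < \<infinity>"
    by (simp add: emeasure_restrict_space space_restrict_space)
  show ?thesis
  proof (cases "p = \<infinity>")
    case True
    then obtain C where C: "AE x in ?M. norm (g x) \<le> C"
      using assms(1) by (auto simp: in_Lp_def)
    have "(\<integral>\<^sup>+x. ennreal (norm (g x)) \<partial>?M) \<le> (\<integral>\<^sup>+x. ennreal C \<partial>?M)"
      by (intro nn_integral_mono_AE eventually_mono[OF C] ennreal_leI)
    also have "\<dots> < \<infinity>" using fin by (simp add: ennreal_mult_less_top)
    finally show ?thesis .
  next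
    case False
    define q where "q = real_of_ereal p"
    have q: "1 \<le> q" using assms(2) False by (cases p) (auto simp: q_def)
    have le: "y \<le> 1 + y powr q" if "0 \<le> y" for y :: real
    proof (cases "y \<le> 1")
      case True
      then show ?thesis using powr_ge_zero[of y q] by linarith
    next
      case False
      then show ?thesis using powr_mono[of 1 q y] q by simp
    qed
    have "(\<integral>\<^sup>+x. ennreal (norm (g x)) \<partial>?M) \<le> (\<integral>\<^sup>+x. 1 + ennreal (norm (g x) powr q) \<partial>?M)"
    proof (rule nn_integral_mono)
      fix x
      have "ennreal (norm (g x)) \<le> ennreal (1 + norm (g x) powr q)"
        by (intro ennreal_leI le) simp
      then show "ennreal (norm (g x)) \<le> 1 + ennreal (norm (g x) powr q)"
        by simp
    qed
    also have "\<dots> = emeasure ?M (space ?M) + (\<integral>\<^sup>+x. ennreal (norm (g x) powr q) \<partial>?M)"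
      by (subst nn_integral_add) auto
    also have "\<dots> < \<infinity>"
      using fin False assms(1) by (simp add: in_Lp_def q_def integrable_iff_bounded)
    finally show ?thesis .
  qed
qed

lemma W_cong:
  fixes E :: "(real ^ 'n) set"
  assumes "AE x in lborel. x \<in> E \<longleftrightarrow> P x"
  shows "W \<gamma> E = (\<integral>\<^sup>+x. (if P x then ennreal (norm x powr (\<gamma> - real CARD('n))) else 0) \<partial>lborel)"
  unfolding W_def nn_integral_completion
  by (intro nn_integral_cong_AE eventually_mono[OF assms]) (auto simp: indicator_def)

lemma AE_surface_measure_iff:
  "(AE \<theta> in surface_measure. P \<theta>) \<longleftrightarrow> (AE \<theta> in borel_surface_measure. P (\<theta> :: real ^ 'n))"
  unfolding surface_measure_def by (rule AE_completion_iff)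

lemma AE_lborel_real_Icc_nonempty:
  fixes a b :: real
  assumes "AE r in lborel. P r" "a < b"
  obtains r where "a \<le> r" "r \<le> b" "P r"
proof -
  have "\<not> (AE r in lborel. r \<notin> {a..b})"
    using assms(2) by (subst AE_iff_measurable[of "{a..b}"]) auto
  moreover have "AE r in lborel. r \<notin> {a..b}" if "\<And>r. a \<le> r \<Longrightarrow> r \<le> b \<Longrightarrow> \<not> P r"
    using assms(1) by eventually_elim (use that in auto)
  ultimately show thesis using that by blast
qed

text \<open>Since \<open>g\<close> and \<open>h\<close> agree only almost everywhere,
  \<open>h\<close> itself may lack radial limits. The limit of \<open>g\<close> is therefore
  recovered from \<open>h\<close> along a sequence of radii on whose spheres the two agree almost
  everywhere.\<close>

lemma radial_limit_borel_version:
  fixes g :: "real ^ 'n \<Rightarrow> complex" and h :: "real ^ 'n \<Rightarrow> real"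
  assumes [measurable]: "h \<in> borel_measurable borel"
    and h: "AE x in lborel. norm (g x) = h x"
    and lim: "AE \<theta> in borel_surface_measure.
      \<exists>l. ((\<lambda>r. r ^ CARD('n) * norm (g (r *\<^sub>R \<theta>))) \<longlongrightarrow> l) at_top"
  obtains A where "A \<in> borel_measurable borel" "\<And>\<theta>. 0 \<le> A \<theta>"
    "AE \<theta> in borel_surface_measure. ((\<lambda>r. r ^ CARD('n) * norm (g (r *\<^sub>R \<theta>))) \<longlongrightarrow> A \<theta>) at_top"
    "AE \<theta> in borel_surface_measure. radial_limit g \<theta> = A \<theta>"
proof -
  let ?n = "CARD('n)"
  \<comment> \<open>Almost every radius is admissible, so the interval from \<open>k + 1\<close> to
    \<open>k + 2\<close>, having positive length, contains one.\<close>
  have "\<exists>r\<ge>real k + 1. AE \<theta> in borel_surface_measure. norm (g (r *\<^sub>R \<theta>)) = h (r *\<^sub>R \<theta>)" for k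
  proof -
    obtain r where "real k + 1 \<le> r" "0 < r \<longrightarrow> (AE \<theta> in borel_surface_measure. norm (g (r *\<^sub>R \<theta>)) = h (r *\<^sub>R \<theta>))"
      by (rule AE_lborel_real_Icc_nonempty[OF AE_lborel_imp_AE_spheres[OF h], of "real k + 1" "real k + 2"]) auto
    then show ?thesis by (intro exI[of _ r]) auto
  qed
  then obtain r where r: "\<And>k. real k + 1 \<le> r k"
    and rh: "\<And>k. AE \<theta> in borel_surface_measure. norm (g (r k *\<^sub>R \<theta>)) = h (r k *\<^sub>R \<theta>)"
    by metis
  have r_top: "filterlim r at_top sequentially"
  proof (rule filterlim_at_top_mono[OF filterlim_real_sequentially])
    have "real k \<le> r k" for k using r[of k] by linarith
    then show "eventually (\<lambda>k. real k \<le> r k) sequentially" by simp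
  qed
  have rh_all: "AE \<theta> in borel_surface_measure. \<forall>k. norm (g (r k *\<^sub>R \<theta>)) = h (r k *\<^sub>R \<theta>)"
    using rh by (simp add: AE_all_countable)
  \<comment> \<open>Truncation at \<open>0\<close> ensures \<open>0 \<le> A \<theta>\<close> also
    where the sequence diverges and \<open>lim\<close> is unspecified.\<close>
  define A where "A \<theta> = max 0 (lim (\<lambda>k. r k ^ ?n * h (r k *\<^sub>R \<theta>)))" for \<theta>
  have A_lim: "AE \<theta> in borel_surface_measure. ((\<lambda>r. r ^ ?n * norm (g (r *\<^sub>R \<theta>))) \<longlongrightarrow> A \<theta>) at_top"
    using lim rh_all
  proof eventually_elim
    case (elim \<theta>)
    then obtain l where l: "((\<lambda>r. r ^ ?n * norm (g (r *\<^sub>R \<theta>))) \<longlongrightarrow> l) at_top" by blast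
    have "(\<lambda>k. r k ^ ?n * h (r k *\<^sub>R \<theta>)) \<longlonglongrightarrow> l"
      using filterlim_compose[OF l r_top] elim(2) by simp
    then have "lim (\<lambda>k. r k ^ ?n * h (r k *\<^sub>R \<theta>)) = l" by (rule limI)
    moreover have "0 \<le> l"
      by (rule tendsto_lowerbound[OF l])
        (auto intro!: eventually_mono[OF eventually_ge_at_top[of 0]])
    ultimately show ?case using l by (simp add: A_def)
  qed
  show thesis
  proof
    show "A \<in> borel_measurable borel" unfolding A_def by measurable
    show "AE \<theta> in borel_surface_measure. radial_limit g \<theta> = A \<theta>"
      using A_lim unfolding radial_limit_def by eventually_elim (simp add: tendsto_Lim)
  qed (use A_lim in \<open>auto simp: A_def\<close>)
qed

section \<open>From Borel data to the given function\<close>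

proposition weighted_level_set_limit:
  fixes g :: "real ^ 'n \<Rightarrow> complex" and G :: "real ^ 'n \<Rightarrow> real" and R \<gamma> :: real
  assumes g: "g \<in> borel_measurable lebesgue"
    and R: "0 < R"
    and G: "integrable surface_measure G"
    and Lp: "1 \<le> p" "in_Lp p (ball 0 R) g"
    and dom: "\<And>r. R \<le> r \<Longrightarrow>
      AE \<theta> in surface_measure. r ^ CARD('n) * norm (g (r *\<^sub>R \<theta>)) \<le> G \<theta>"
    and lim: "AE \<theta> in surface_measure. \<exists>l. ((\<lambda>r. r ^ CARD('n) * norm (g (r *\<^sub>R \<theta>))) \<longlongrightarrow> l) at_top"
    and \<gamma>: "\<gamma> \<noteq> 0"
  shows "((\<lambda>t. ennreal (t powr - \<gamma>) * W \<gamma> {x. norm (g x) / norm x powr (\<gamma> - real CARD('n)) > t powr - \<gamma>})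
    \<longlongrightarrow> ennreal (1 / \<bar>\<gamma>\<bar> * (\<integral>\<theta>. radial_limit g \<theta> \<partial>surface_measure))) at_top"
proof (rule tendsto_at_topI_sequentially)
  let ?n = "CARD('n)"
  fix t0 :: "nat \<Rightarrow> real" assume t0: "filterlim t0 at_top sequentially"
  \<comment> \<open>The two sequences agree for all large \<open>k\<close>, and the new one is
    positive throughout.\<close>
  define t where "t k = max 1 (t0 k)" for k
  have t_pos: "0 < t k" for k by (simp add: t_def)
  have t_eq: "eventually (\<lambda>k. t k = t0 k) sequentially"
    using filterlim_at_top[THEN iffD1, OF t0, rule_format, of 1]
    by eventually_elim (simp add: t_def)
  have t: "filterlim t at_top sequentially"
    by (rule filterlim_at_top_mono[OF t0]) (simp add: t_def)

  have dom': "AE \<theta> in borel_surface_measure. r ^ ?n * norm (g (r *\<^sub>R \<theta>)) \<le> G \<theta>" if "R \<le> r" for r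
    using dom[OF that] by (simp only: AE_surface_measure_iff)
  have lim': "AE \<theta> in borel_surface_measure. \<exists>l. ((\<lambda>r. r ^ ?n * norm (g (r *\<^sub>R \<theta>))) \<longlongrightarrow> l) at_top"
    using lim by (simp only: AE_surface_measure_iff)

  have "(\<lambda>x. norm (g x)) \<in> borel_measurable lebesgue" using g by measurable
  then obtain h0 where "h0 \<in> borel_measurable lborel" "AE x in lborel. norm (g x) = h0 x"
    using completion_ex_borel_measurable_real by blast
  define h where "h x = max 0 (h0 x)" for x
  have h_meas[measurable]: "h \<in> borel_measurable borel"
    unfolding h_def using \<open>h0 \<in> borel_measurable lborel\<close> by auto
  have h: "AE x in lborel. norm (g x) = h x"
    using \<open>AE x in lborel. norm (g x) = h0 x\<close> 
    by eventually_elim (metis h_def max_absorb2 norm_ge_zero)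
  have h0: "0 \<le> h x" for x by (simp add: h_def)

  obtain G0 where "G0 \<in> borel_measurable borel" "AE \<theta> in borel_surface_measure. G \<theta> = G0 \<theta>"
    using surface_measurable_borel_version[OF borel_measurable_integrable[OF G]] .
  define G' where "G' \<theta> = max 0 (G0 \<theta>)" for \<theta>
  have G'_meas[measurable]: "G' \<in> borel_measurable borel"
    unfolding G'_def using \<open>G0 \<in> borel_measurable borel\<close> by auto
  have G': "AE \<theta> in borel_surface_measure. G' \<theta> = max 0 (G \<theta>)"
    using \<open>AE \<theta> in borel_surface_measure. G \<theta> = G0 \<theta>\<close> by eventually_elim (simp add: G'_def)
  have G'_fin: "(\<integral>\<^sup>+\<theta>. ennreal (G' \<theta>) \<partial>borel_surface_measure) < \<infinity>"
  proof -
    have "(\<integral>\<^sup>+\<theta>. ennreal (G' \<theta>) \<partial>borel_surface_measure) \<le> (\<integral>\<^sup>+\<theta>. ennreal (norm (G \<theta>)) \<partial>borel_surface_measure)"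
      by (intro nn_integral_mono_AE eventually_mono[OF G']) (auto intro!: ennreal_leI)
    also have "\<dots> = (\<integral>\<^sup>+\<theta>. ennreal (norm (G \<theta>)) \<partial>surface_measure)"
      by (simp add: surface_measure_def nn_integral_completion)
    also have "\<dots> < \<infinity>" using G by (simp add: integrable_iff_bounded)
    finally show ?thesis .
  qed

  obtain A where A_meas[measurable]: "A \<in> borel_measurable borel" and A0: "\<And>\<theta>. 0 \<le> A \<theta>"
    and A_lim: "AE \<theta> in borel_surface_measure. ((\<lambda>r. r ^ ?n * norm (g (r *\<^sub>R \<theta>))) \<longlongrightarrow> A \<theta>) at_top"
    and A_eq: "AE \<theta> in borel_surface_measure. radial_limit g \<theta> = A \<theta>"
    using radial_limit_borel_version[OF h_meas h lim'] by blast

  have inner: "(\<integral>\<^sup>+x. (if norm x < R then ennreal (h x) else 0) \<partial>lborel) < \<infinity>"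
  proof -
    have "(\<integral>\<^sup>+x. (if norm x < R then ennreal (h x) else 0) \<partial>lborel) =
        (\<integral>\<^sup>+x. ennreal (norm (g x)) * indicator (ball 0 R) x \<partial>lborel)"
      by (intro nn_integral_cong_AE eventually_mono[OF h]) (auto simp: indicator_def)
    also have "\<dots> = (\<integral>\<^sup>+x. ennreal (norm (g x)) \<partial>lebesgue_on (ball 0 R))"
      by (simp add: nn_integral_restrict_space nn_integral_completion)
    also have "\<dots> < \<infinity>" using in_Lp_nn_integral_finite[OF Lp(2,1)] .
    finally show ?thesis .
  qed

  have outer: "AE x in lborel. R \<le> norm x \<longrightarrow> norm x ^ ?n * h x \<le> G' (sgn x)"
  proof -
    define N where "N = {x. R \<le> norm x \<and> G' (sgn x) < norm x ^ ?n * h x}"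
    have [measurable]: "N \<in> sets borel" unfolding N_def by measurable
    \<comment> \<open>The bound is known one sphere at a time, with an exceptional set that depends
      on the radius. As \<open>N\<close> is Borel, nullity on almost every sphere makes it null in
      the space.\<close>
    have "AE r in lborel. 0 < r \<longrightarrow> (AE \<theta> in borel_surface_measure. r *\<^sub>R \<theta> \<notin> N)"
      using AE_lborel_imp_AE_spheres[OF h]
    proof (eventually_elim, intro impI)
      fix r :: real
      assume r: "0 < r" and "0 < r \<longrightarrow> (AE \<theta> in borel_surface_measure. norm (g (r *\<^sub>R \<theta>)) = h (r *\<^sub>R \<theta>))"
      then have hr: "AE \<theta> in borel_surface_measure. norm (g (r *\<^sub>R \<theta>)) = h (r *\<^sub>R \<theta>)" by simp
      have "AE \<theta> in borel_surface_measure. R \<le> r \<longrightarrow> r ^ ?n * norm (g (r *\<^sub>R \<theta>)) \<le> G \<theta>"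
        using dom'[of r] by (cases "R \<le> r") auto
      then show "AE \<theta> in borel_surface_measure. r *\<^sub>R \<theta> \<notin> N"
        using hr G' AE_space
      proof eventually_elim
        case (elim \<theta>)
        then have "norm (r *\<^sub>R \<theta>) = r" "sgn (r *\<^sub>R \<theta>) = \<theta>" using r by (auto simp: sgn_div_norm)
        then show ?case using elim by (auto simp: N_def)
      qed
    qed
    then have "AE x in lborel. x \<notin> N" by (subst AE_lborel_polar_iff(2)) auto
    then show ?thesis by eventually_elim (auto simp: N_def not_less)
  qed

  have h_t: "AE x in lborel. \<forall>k. norm (g (t k *\<^sub>R x)) = h (t k *\<^sub>R x)"
    using AE_lborel_scaleR[OF h t_pos] by (simp add: AE_all_countable)
  \<comment> \<open>The points \<open>t k *\<^sub>R x\<close> lie on the ray in direction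
    \<open>sgn x\<close> at radii \<open>t k * norm x\<close>, which tend to infinity unless
    \<open>x = 0\<close>.\<close>
  have seq: "AE x in lborel. (\<lambda>k. norm (t k *\<^sub>R x) ^ ?n * h (t k *\<^sub>R x)) \<longlonglongrightarrow> A (sgn x)"
    using AE_lborel_sgn[OF A_lim] AE_lborel_singleton[of 0] h_t
  proof eventually_elim
    case (elim x)
    have "filterlim (\<lambda>k. t k * norm x) at_top sequentially"
      using elim t by (intro filterlim_at_top_mult_tendsto_pos[OF tendsto_const]) auto
    from filterlim_compose[OF elim(1) this]
    have "(\<lambda>k. (t k * norm x) ^ ?n * norm (g ((t k * norm x) *\<^sub>R sgn x))) \<longlonglongrightarrow> A (sgn x)" .
    moreover have "(t k * norm x) *\<^sub>R sgn x = t k *\<^sub>R x" "norm (t k *\<^sub>R x) = t k * norm x" for k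
      using elim t_pos[of k] by (auto simp: sgn_div_norm)
    ultimately show ?case using elim(3) by (simp only:)
  qed

  have "ennreal (1 / \<bar>\<gamma>\<bar>) * (\<integral>\<^sup>+\<theta>. ennreal (A \<theta>) \<partial>borel_surface_measure) =
      ennreal (1 / \<bar>\<gamma>\<bar> * (\<integral>\<theta>. radial_limit g \<theta> \<partial>surface_measure))"
  proof -
    have A_S: "A \<in> borel_measurable borel_surface_measure"
      by (rule borel_measurable_borel_surface_measure) measurable
    \<comment> \<open>The bound is used only at the countably many radii \<open>R + k\<close>, whose
      exceptional sets have a null union. The result makes \<open>A\<close> integrable, so that its
      nonnegative integral and its Bochner integral coincide.\<close>
    have A_le: "AE \<theta> in borel_surface_measure. A \<theta> \<le> G' \<theta>"
    proof -
      have *: "AE \<theta> in borel_surface_measure. (R + real k) ^ ?n * norm (g ((R + real k) *\<^sub>R \<theta>)) \<le> G \<theta>" for k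
        by (rule dom') simp
      then have "AE \<theta> in borel_surface_measure. \<forall>k. (R + real k) ^ ?n * norm (g ((R + real k) *\<^sub>R \<theta>)) \<le> G \<theta>"
        by (simp add: AE_all_countable)
      with A_lim G' show ?thesis
      proof eventually_elim
        case (elim \<theta>)
        have "filterlim (\<lambda>k. R + real k) at_top sequentially"
          by (intro filterlim_tendsto_add_at_top[OF tendsto_const] filterlim_real_sequentially)
        from filterlim_compose[OF elim(1) this] have "A \<theta> \<le> G \<theta>"
          by (rule tendsto_upperbound) (use elim(3) in auto)
        then show ?case using elim(2) by simp
      qed
    qed
    have "(\<integral>\<^sup>+\<theta>. ennreal (A \<theta>) \<partial>borel_surface_measure) \<le> (\<integral>\<^sup>+\<theta>. ennreal (G' \<theta>) \<partial>borel_surface_measure)"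
      by (intro nn_integral_mono_AE eventually_mono[OF A_le] ennreal_leI)
    then have "integrable borel_surface_measure A"
      using A_S A0 G'_fin by (auto simp: integrable_iff_bounded)
    then have "(\<integral>\<^sup>+\<theta>. ennreal (A \<theta>) \<partial>borel_surface_measure) = ennreal (\<integral>\<theta>. A \<theta> \<partial>borel_surface_measure)"
      using A0 by (intro nn_integral_eq_integral) auto
    also have "(\<integral>\<theta>. A \<theta> \<partial>borel_surface_measure) = (\<integral>\<theta>. A \<theta> \<partial>surface_measure)"
      unfolding surface_measure_def by (rule integral_completion[symmetric]) fact
    also have "\<dots> = (\<integral>\<theta>. radial_limit g \<theta> \<partial>surface_measure)"
    proof (rule integral_cong_AE)
      show "A \<in> borel_measurable surface_measure"
        unfolding surface_measure_def by (rule measurable_completion[OF A_S])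
      show "radial_limit g \<in> borel_measurable surface_measure"
        by (rule borel_measurable_surface_measure_AE[OF A_S A_eq])
      show "AE \<theta> in surface_measure. A \<theta> = radial_limit g \<theta>"
        using A_eq by (simp add: AE_surface_measure_iff eq_commute)
    qed
    finally show ?thesis by (subst ennreal_mult') auto
  qed
  moreover have "W \<gamma> {x. norm (g x) / norm x powr (\<gamma> - real ?n) > s} =
      (\<integral>\<^sup>+x. (if s < h x / norm x powr (\<gamma> - real ?n) then ennreal (norm x powr (\<gamma> - real ?n)) else 0) \<partial>lborel)" for s
    by (rule W_cong, rule eventually_mono[OF h]) simp
  moreover note weighted_level_set_tendsto[OF h_meas G'_meas A_meas h0 _ A0 \<gamma> R inner outer G'_fin t_pos t seq]
  ultimately have "(\<lambda>k. ennreal (t k powr - \<gamma>) * W \<gamma> {x. norm (g x) / norm x powr (\<gamma> - real ?n) > t k powr - \<gamma>})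
      \<longlonglongrightarrow> ennreal (1 / \<bar>\<gamma>\<bar> * (\<integral>\<theta>. radial_limit g \<theta> \<partial>surface_measure))"
    by (simp add: G'_def)
  then show "(\<lambda>k. ennreal (t0 k powr - \<gamma>) * W \<gamma> {x. norm (g x) / norm x powr (\<gamma> - real ?n) > t0 k powr - \<gamma>})
      \<longlonglongrightarrow> ennreal (1 / \<bar>\<gamma>\<bar> * (\<integral>\<theta>. radial_limit g \<theta> \<partial>surface_measure))"
    by (rule Lim_transform_eventually) (use t_eq in \<open>auto elim!: eventually_mono\<close>)
qed

section \<open>Return to the level parameter in both regimes\<close>

theorem theorem1p7:
  fixes T :: "('s \<Rightarrow> 't) \<Rightarrow> (real ^ 'n \<Rightarrow> complex)" and f :: "'s \<Rightarrow> 't"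
    and R0 :: real and p0 :: ereal and G :: "real ^ 'n \<Rightarrow> real"
  assumes "T f \<in> borel_measurable lebesgue"
    and "1 \<le> R0"
    and "integrable surface_measure G"
    and "1 < p0"
    and "in_Lp p0 (ball 0 R0) (T f)"
    and "\<And>r. R0 \<le> r \<Longrightarrow>
           AE \<theta> in surface_measure. r ^ CARD('n) * norm (T f (r *\<^sub>R \<theta>)) \<le> G \<theta>"
    and "AE \<theta> in surface_measure.
           \<exists>l. ((\<lambda>r. r ^ CARD('n) * norm (T f (r *\<^sub>R \<theta>))) \<longlongrightarrow> l) at_top"
  shows "(\<forall>\<gamma>>0.
            ((\<lambda>s. ennreal s * W \<gamma> {x. norm (T f x) / norm x powr (\<gamma> - real CARD('n)) > s})
              \<longlongrightarrow> ennreal (1 / \<gamma> * (\<integral>\<theta>. radial_limit (T f) \<theta> \<partial>surface_measure))) (at_right 0)) \<and>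
         (\<forall>\<gamma><0.
            ((\<lambda>s. ennreal s * W \<gamma> {x. norm (T f x) / norm x powr (\<gamma> - real CARD('n)) > s})
              \<longlongrightarrow> ennreal (1 / (- \<gamma>) * (\<integral>\<theta>. radial_limit (T f) \<theta> \<partial>surface_measure))) at_top)"
proof -
  define F where "F \<gamma> s = ennreal s * W \<gamma> {x. norm (T f x) / norm x powr (\<gamma> - real CARD('n)) > s}" for \<gamma> s
  define L where "L \<gamma> = ennreal (1 / \<bar>\<gamma>\<bar> * (\<integral>\<theta>. radial_limit (T f) \<theta> \<partial>surface_measure))" for \<gamma>
  have lim: "((\<lambda>t. F \<gamma> (t powr - \<gamma>)) \<longlongrightarrow> L \<gamma>) at_top" if "\<gamma> \<noteq> 0" for \<gamma>
    unfolding F_def L_def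
    by (rule weighted_level_set_limit[OF assms(1) _ assms(3) _ assms(5-7) that]) (use assms(2,4) in auto)
  \<comment> \<open>The inverse of \<open>s = t powr - \<gamma>\<close> is
    \<open>t = s powr (- 1 / \<gamma>)\<close>. It tends to infinity as \<open>s\<close> decreases
    to \<open>0\<close> for a positive exponent, and as \<open>s\<close> tends to infinity for a
    negative one.\<close>
  have subst: "(F \<gamma> \<longlongrightarrow> L \<gamma>) S"
    if "\<gamma> \<noteq> 0" "filterlim (\<lambda>s. s powr (- 1 / \<gamma>)) at_top S" "eventually (\<lambda>s. 0 < s) S" for \<gamma> S
  proof (rule Lim_transform_eventually[OF filterlim_compose[OF lim that(2)]])
    show "eventually (\<lambda>s. F \<gamma> ((s powr (- 1 / \<gamma>)) powr - \<gamma>) = F \<gamma> s) S"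
      using that(3) by eventually_elim (use that(1) in \<open>simp add: powr_powr\<close>)
  qed (use that in auto)
  have "(F \<gamma> \<longlongrightarrow> L \<gamma>) (at_right 0)" if "\<gamma> > 0" for \<gamma>
  proof (rule subst)
    have pos: "eventually (\<lambda>s :: real. 0 < s) (at_right 0)"
      by (rule eventually_at_right_less)
    then show "eventually (\<lambda>s :: real. 0 < s) (at_right 0)" .
    have "filterlim (\<lambda>s :: real. inverse s powr (1 / \<gamma>)) at_top (at_right 0)"
      using that by (intro filterlim_powr_at_top filterlim_inverse_at_top_right) auto
    then show "filterlim (\<lambda>s :: real. s powr (- 1 / \<gamma>)) at_top (at_right 0)"
      by (rule filterlim_cong[OF refl refl, THEN iffD1, rotated])
        (use pos in \<open>auto elim!: eventually_mono simp: inverse_powr powr_minus\<close>)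
  qed (use that in auto)
  moreover have "(F \<gamma> \<longlongrightarrow> L \<gamma>) at_top" if "\<gamma> < 0" for \<gamma>
    using that by (intro subst filterlim_powr_at_top filterlim_ident eventually_gt_at_top)
      (auto simp: divide_neg_neg)
  ultimately show ?thesis
    by (auto simp: F_def[abs_def] L_def)
qed

end
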